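(* The monoid $\mathcal{L}$ of Left dead ends is an FF-monoid: every Left dead end has a factorisation into atoms, the lengths of its factorisations are bounded, and it has only finitely many factorisations.
   Context: All games are short partizan combinatorial game forms; $G+H$ is the disjunctive sum. Play is misère (a player unable to move wins). Misère outcome classes are ordered $\mathscr L>\mathscr P>\mathscr R$ and $\mathscr L>\mathscr N>\mathscr R$; $G\geq H$ means that for every game $X$ the misère outcome of $G+X$ is $\geq$ that of $H+X$, and $G=H$ means $G\ge H$ and $H\ge G$. A Left dead end is a game no subposition of which (including itself) has a Left option. The Left dead ends, taken up to equality, form a commutative monoid $\mathcal{L}$ under $+$ with identity $0=\{\cdot\mid\cdot\}$, in which $0$ is the only invertible element. An atom is a Left dead end $A\neq 0$ such that whenever $A=H+K$ with $H,K$ Left dead ends, $H=0$ or $K=0$. A factorisation of $G$ is an expression $G=A_1+\dots+A_k$ ($k\geq0$) with atoms $A_i$, considered up to reordering and up to replacing atoms by equal ones; its length is $k$. *)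

theory Defs
  imports "HOL-Library.FSet" "HOL-Library.Multiset"
begin

datatype game = Game (left_opts: "game fset") (right_opts: "game fset")

lemma size_left_option [termination_simp]:
  "H |\<in>| left_opts G \<Longrightarrow> size H < size G"
proof (cases G)
  case (Game L R)
  assume "H |\<in>| left_opts G"
  with Game have "H \<in> fset L" by simp
  then have "Suc (size H) \<le> (\<Sum>x\<in>fset L. Suc (size x))"
    by (intro member_le_sum) auto
  with Game show ?thesis by simp
qed

lemma size_right_option [termination_simp]:
  "H |\<in>| right_opts G \<Longrightarrow> size H < size G"
proof (cases G)
  case (Game L R)
  assume "H |\<in>| right_opts G"
  with Game have "H \<in> fset R" by simp
  then have "Suc (size H) \<le> (\<Sum>x\<in>fset R. Suc (size x))"
    by (intro member_le_sum) auto
  with Game show ?thesis by simp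
qed

lemma game_induct [case_names step]:
  assumes "\<And>G. (\<And>H. H |\<in>| left_opts G \<Longrightarrow> P H) \<Longrightarrow>
    (\<And>H. H |\<in>| right_opts G \<Longrightarrow> P H) \<Longrightarrow> P G"
  shows "P G"
  by (induction G rule: measure_induct_rule[where f = size])
    (use assms size_left_option size_right_option in blast)


section \<open>Disjunctive sum\<close>

instantiation game :: comm_monoid_add
begin

definition zero_game :: game where
  "0 = Game {||} {||}"

declare fimage_cong [fundef_cong]

function plus_game :: "game \<Rightarrow> game \<Rightarrow> game" where
  "plus_game G H = Game
    ((\<lambda>G'. plus_game G' H) |`| left_opts G |\<union>| (\<lambda>H'. plus_game G H') |`| left_opts H)
    ((\<lambda>G'. plus_game G' H) |`| right_opts G |\<union>| (\<lambda>H'. plus_game G H') |`| right_opts H)"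
  by pat_completeness auto
termination
  by (relation "measure (\<lambda>(G, H). size G + size H)")
    (auto dest: size_left_option size_right_option)

declare plus_game.simps [simp del]

lemma left_opts_plus [simp]: "left_opts (G + H) =
    (\<lambda>G'. G' + H) |`| left_opts G |\<union>| (\<lambda>H'. G + H') |`| left_opts H"
  for G H :: game
  by (subst plus_game.simps) simp

lemma right_opts_plus [simp]: "right_opts (G + H) =
    (\<lambda>G'. G' + H) |`| right_opts G |\<union>| (\<lambda>H'. G + H') |`| right_opts H"
  for G H :: game
  by (subst plus_game.simps) simp

lemma plus_game_commute: "G + H = H + (G :: game)"
proof (induction G H rule: plus_game.induct)
  case (1 G H)
  have "left_opts (G + H) = left_opts (H + G)"
    using 1(1,2) by (simp add: sup_commute cong: fimage_cong)
  moreover have "right_opts (G + H) = right_opts (H + G)"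
    using 1(3,4) by (simp add: sup_commute cong: fimage_cong)
  ultimately show ?case by (rule game.expand[OF conjI])
qed

lemma plus_game_assoc: "(G + H) + K = G + (H + (K :: game))"
proof (induction "size G + size H + size K" arbitrary: G H K rule: less_induct)
  case less
  have G: "(G' + H) + K = G' + (H + K)"
    if "G' |\<in>| left_opts G \<or> G' |\<in>| right_opts G" for G'
    using that by (intro less) (auto dest: size_left_option size_right_option)
  have H: "(G + H') + K = G + (H' + K)"
    if "H' |\<in>| left_opts H \<or> H' |\<in>| right_opts H" for H'
    using that by (intro less) (auto dest: size_left_option size_right_option)
  have K: "(G + H) + K' = G + (H + K')"
    if "K' |\<in>| left_opts K \<or> K' |\<in>| right_opts K" for K'
    using that by (intro less) (auto dest: size_left_option size_right_option)
  have "left_opts ((G + H) + K) = left_opts (G + (H + K))"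
    using G H K by (simp add: fimage_funion fset.map_comp o_def sup_assoc cong: fimage_cong)
  moreover have "right_opts ((G + H) + K) = right_opts (G + (H + K))"
    using G H K by (simp add: fimage_funion fset.map_comp o_def sup_assoc cong: fimage_cong)
  ultimately show ?case by (rule game.expand[OF conjI])
qed

lemma zero_plus_game: "0 + G = (G :: game)"
proof (induction G rule: game_induct)
  case (step G)
  have "left_opts (0 + G) = left_opts G"
    using step(1) by (simp add: zero_game_def cong: fimage_cong)
  moreover have "right_opts (0 + G) = right_opts G"
    using step(2) by (simp add: zero_game_def cong: fimage_cong)
  ultimately show ?case by (rule game.expand[OF conjI])
qed

instance
  by standard (rule plus_game_assoc plus_game_commute zero_plus_game)+

end


section \<open>Misere outcomes and the order on games\<close>

text \<open>The player to move wins if she has no move, or if she can move to a position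
  from which her opponent, moving first, does not win.\<close>

fun left_wins_first :: "game \<Rightarrow> bool" and right_wins_first :: "game \<Rightarrow> bool" where
  "left_wins_first G \<longleftrightarrow>
    left_opts G = {||} \<or> (\<exists>G' |\<in>| left_opts G. \<not> right_wins_first G')"
| "right_wins_first G \<longleftrightarrow>
    right_opts G = {||} \<or> (\<exists>G' |\<in>| right_opts G. \<not> left_wins_first G')"

declare left_wins_first.simps [simp del] right_wins_first.simps [simp del]

datatype outcome = Left_win | Next_win | Previous_win | Right_win

instantiation outcome :: order
begin

definition less_eq_outcome :: "outcome \<Rightarrow> outcome \<Rightarrow> bool" where
  "x \<le> y \<longleftrightarrow> x = y \<or> x = Right_win \<or> y = Left_win"

definition less_outcome :: "outcome \<Rightarrow> outcome \<Rightarrow> bool" where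
  "x < y \<longleftrightarrow> x \<le> y \<and> x \<noteq> (y :: outcome)"

instance
  by standard (auto simp: less_eq_outcome_def less_outcome_def)

end

definition misere_outcome :: "game \<Rightarrow> outcome" where
  "misere_outcome G =
    (if left_wins_first G
     then (if right_wins_first G then Next_win else Left_win)
     else (if right_wins_first G then Right_win else Previous_win))"

definition game_ge :: "game \<Rightarrow> game \<Rightarrow> bool" where
  "game_ge G H \<longleftrightarrow> (\<forall>X. misere_outcome (G + X) \<ge> misere_outcome (H + X))"

definition game_eq :: "game \<Rightarrow> game \<Rightarrow> bool" where
  "game_eq G H \<longleftrightarrow> game_ge G H \<and> game_ge H G"

lemma game_eq_iff: "game_eq G H \<longleftrightarrow> (\<forall>X. misere_outcome (G + X) = misere_outcome (H + X))"
  by (auto simp: game_eq_def game_ge_def intro: antisym)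

lemma game_eq_plus: "game_eq G G' \<Longrightarrow> game_eq H H' \<Longrightarrow> game_eq (G + H) (G' + H')"
  unfolding game_eq_iff by (metis add.assoc add.commute)


section \<open>The monoid of Left dead ends\<close>

inductive subposition :: "game \<Rightarrow> game \<Rightarrow> bool" where
  subposition_refl: "subposition G G"
| subposition_left: "subposition H G \<Longrightarrow> K |\<in>| left_opts H \<Longrightarrow> subposition K G"
| subposition_right: "subposition H G \<Longrightarrow> K |\<in>| right_opts H \<Longrightarrow> subposition K G"

definition left_dead_end :: "game \<Rightarrow> bool" where
  "left_dead_end G \<longleftrightarrow> (\<forall>H. subposition H G \<longrightarrow> left_opts H = {||})"

lemma subposition_zero: "subposition H G \<Longrightarrow> G = 0 \<Longrightarrow> H = 0"
  by (induction rule: subposition.induct) (simp_all add: zero_game_def)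

lemma left_dead_end_zero: "left_dead_end 0"
  unfolding left_dead_end_def by (metis subposition_zero zero_game_def game.sel(1))

lemma subposition_plus:
  assumes "subposition K (G + H)"
  shows "\<exists>G' H'. K = G' + H' \<and> subposition G' G \<and> subposition H' H"
  using assms
proof (induction K "G + H")
  case subposition_refl
  then show ?case by (blast intro: subposition.intros)
next
  case (subposition_left K K')
  then obtain G' H' where *: "K = G' + H'" "subposition G' G" "subposition H' H" by blast
  from subposition_left have "K' |\<in>| left_opts (G' + H')" by (simp add: *)
  then consider G'' where "K' = G'' + H'" "G'' |\<in>| left_opts G'"
    | H'' where "K' = G' + H''" "H'' |\<in>| left_opts H'"
    unfolding left_opts_plus by blast
  then show ?case
    using * by cases (blast intro: subposition.subposition_left)+
next
  case (subposition_right K K')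
  then obtain G' H' where *: "K = G' + H'" "subposition G' G" "subposition H' H" by blast
  from subposition_right have "K' |\<in>| right_opts (G' + H')" by (simp add: *)
  then consider G'' where "K' = G'' + H'" "G'' |\<in>| right_opts G'"
    | H'' where "K' = G' + H''" "H'' |\<in>| right_opts H'"
    unfolding right_opts_plus by blast
  then show ?case
    using * by cases (blast intro: subposition.subposition_right)+
qed

lemma left_dead_end_plus: "left_dead_end G \<Longrightarrow> left_dead_end H \<Longrightarrow> left_dead_end (G + H)"
  by (auto simp: left_dead_end_def dest!: subposition_plus)

text \<open>Elements of the monoid are equivalence classes of Left dead ends; the equality
  itself tests against all games, not only against Left dead ends.\<close>

quotient_type left_dead_ends = game / partial:
  "\<lambda>G H. left_dead_end G \<and> left_dead_end H \<and> game_eq G H"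
proof (rule part_equivpI)
  show "\<exists>G. left_dead_end G \<and> left_dead_end G \<and> game_eq G G"
    using left_dead_end_zero by (auto simp: game_eq_iff)
qed (auto simp: symp_def transp_def game_eq_iff)

instantiation left_dead_ends :: comm_monoid_add
begin

lift_definition zero_left_dead_ends :: left_dead_ends is "0 :: game"
  by (simp add: left_dead_end_zero game_eq_iff)

lift_definition plus_left_dead_ends :: "left_dead_ends \<Rightarrow> left_dead_ends \<Rightarrow> left_dead_ends"
  is "(+) :: game \<Rightarrow> game \<Rightarrow> game"
  by (simp add: left_dead_end_plus game_eq_plus)

instance
  by standard (transfer; simp add: left_dead_end_plus game_eq_iff ac_simps)+

end

definition atom :: "left_dead_ends \<Rightarrow> bool" where
  "atom A \<longleftrightarrow> A \<noteq> 0 \<and> (\<forall>H K. A = H + K \<longrightarrow> H = 0 \<or> K = 0)"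

definition factorisations :: "left_dead_ends \<Rightarrow> left_dead_ends multiset set" where
  "factorisations G = {F. (\<forall>A \<in># F. atom A) \<and> (\<Sum>\<^sub># F) = G}"

end

theory Submission
  imports Defs
begin

text \<open>The maximal number of consecutive moves that Right can make in a Left dead end is additive,
  and it is an invariant of the equivalence class: adding a game in which Left has a forced
  run of exactly \<open>k\<close> waiting moves, which Right must not interrupt, tests whether this number
  exceeds \<open>k\<close>. Only zero has depth zero and only finitely many forms have a given depth, so an
  element has finitely many divisors and its depth bounds the number of its atoms.\<close>

section \<open>Depth and its additivity\<close>

function depth :: "game \<Rightarrow> nat" where
  "depth G = Max (insert 0 ((\<lambda>H. Suc (depth H)) ` fset (right_opts G)))"
  by pat_completeness auto
termination
  by (relation "measure size") (auto dest: size_right_option)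

declare depth.simps [simp del]

lemma depth_right_option: "H |\<in>| right_opts G \<Longrightarrow> Suc (depth H) \<le> depth G"
  by (subst (2) depth.simps) (auto intro: Max_ge)

lemma depth_le: "(\<And>H. H |\<in>| right_opts G \<Longrightarrow> Suc (depth H) \<le> n) \<Longrightarrow> depth G \<le> n"
  by (subst depth.simps) auto

lemma depth_attained:
  assumes "0 < depth G"
  obtains H where "H |\<in>| right_opts G" "depth G = Suc (depth H)"
proof -
  have "depth G \<in> insert 0 ((\<lambda>H. Suc (depth H)) ` fset (right_opts G))"
    by (subst depth.simps) (rule Max_in; simp)
  with assms that show thesis by auto
qed

lemma depth_eq_0_iff: "depth G = 0 \<longleftrightarrow> right_opts G = {||}"
proof
  show "right_opts G = {||}" if "depth G = 0"
    using depth_right_option that by fastforce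
qed (subst depth.simps, simp)

text \<open>A Right move in one summand leaves the other untouched, so longest runs of Right moves
  in the summands can be played one after the other, and every run in the sum splits into two. Left
  options play no part, so all games are allowed here.\<close>

lemma depth_plus: "depth (G + H) = depth G + depth H"
proof (induction G H rule: plus_game.induct)
  case (1 G H)
  show ?case
  proof (rule antisym)
    show "depth (G + H) \<le> depth G + depth H"
    proof (rule depth_le)
      fix K assume "K |\<in>| right_opts (G + H)"
      then consider G' where "K = G' + H" "G' |\<in>| right_opts G"
        | H' where "K = G + H'" "H' |\<in>| right_opts H" by auto
      then show "Suc (depth K) \<le> depth G + depth H"
        by cases (use 1(3,4) depth_right_option in fastforce)+
    qed
    consider "depth G = 0" "depth H = 0" | "0 < depth G" | "0 < depth H" by blast
    then show "depth G + depth H \<le> depth (G + H)"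
    proof cases
      case 2
      then obtain G' where "G' |\<in>| right_opts G" "depth G = Suc (depth G')"
        by (rule depth_attained)
      then show ?thesis
        using depth_right_option[of "G' + H" "G + H"] 1(3) by simp
    next
      case 3
      then obtain H' where "H' |\<in>| right_opts H" "depth H = Suc (depth H')"
        by (rule depth_attained)
      then show ?thesis
        using depth_right_option[of "G + H'" "G + H"] 1(4) by simp
    qed simp
  qed
qed

lemma left_dead_end_left_opts: "left_dead_end G \<Longrightarrow> left_opts G = {||}"
  by (simp add: left_dead_end_def subposition_refl)

lemma left_dead_end_right_option:
  assumes "left_dead_end G" "H |\<in>| right_opts G"
  shows "left_dead_end H"
proof -
  have "subposition K G" if "subposition K H" for K
    using that assms(2)
  proof (induction rule: subposition.induct)
    case (subposition_refl H)
    then show ?case by (rule subposition_right[OF subposition.subposition_refl])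
  qed (auto intro: subposition_left subposition_right)
  with assms(1) show ?thesis by (simp add: left_dead_end_def)
qed

text \<open>With neither Left nor Right options the form is literally \<open>0\<close>, not merely
  equal to it as a game.\<close>

lemma left_dead_end_depth_0: "left_dead_end G \<Longrightarrow> depth G = 0 \<Longrightarrow> G = 0"
  by (simp add: depth_eq_0_iff zero_game_def game.expand left_dead_end_left_opts)

section \<open>Invariance of depth under equality\<close>

primrec left_moves :: "nat \<Rightarrow> game" where
  "left_moves 0 = 0"
| "left_moves (Suc n) = Game {|left_moves n|} {||}"

text \<open>Left has \<open>k\<close> waiting moves before being forced into
  \<open>left_moves N\<close>, the usual form of the integer \<open>N\<close>. The Right option
  \<open>0\<close> is present throughout because a Right without any move would win: once the dead
  end is exhausted, Right has to interrupt.\<close>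

primrec depth_test :: "nat \<Rightarrow> nat \<Rightarrow> game" where
  "depth_test N 0 = Game {|left_moves N|} {|0|}"
| "depth_test N (Suc k) = Game {|depth_test N k|} {|0|}"

lemma right_opts_depth_test [simp]: "right_opts (depth_test N k) = {|0|}"
  by (cases k) simp_all

lemma right_opts_left_moves [simp]: "right_opts (left_moves n) = {||}"
  by (cases n) (simp_all add: zero_game_def)

text \<open>Each Right move in \<open>G\<close> lowers the depth and Left's forced reply lowers
  \<open>n\<close> by one, so the bound persists. Left always has a reply, and Right is the one who
  runs out of moves.\<close>

lemma right_wins_first_left_moves:
  assumes "left_dead_end G" "depth G \<le> n"
  shows "right_wins_first (G + left_moves n)"
  using assms
proof (induction n arbitrary: G)
  case 0
  then have "right_opts G = {||}" by (simp add: depth_eq_0_iff)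
  then show ?case by (simp add: right_wins_first.simps)
next
  case (Suc n)
  show ?case
  proof (cases "right_opts G = {||}")
    case True
    then show ?thesis by (simp add: right_wins_first.simps)
  next
    case False
    then obtain H where H: "H |\<in>| right_opts G" by auto
    then have dead: "left_dead_end H"
      using Suc.prems(1) left_dead_end_right_option by blast
    have "right_wins_first (H + left_moves n)"
      using Suc dead H depth_right_option[OF H] by auto
    then have "\<not> left_wins_first (H + left_moves (Suc n))"
      by (simp add: left_wins_first.simps left_dead_end_left_opts[OF dead])
    with H show ?thesis by (subst right_wins_first.simps) auto
  qed
qed

text \<open>Right loses at once by interrupting the run, because Left then has no moves left. If Left's
  run ends before Right's moves are exhausted, Left is forced into the long run
  \<^term>\<open>left_moves N\<close>, during which Right runs out of moves.\<close>

lemma right_wins_first_depth_test: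
  assumes "left_dead_end G" "depth G \<le> N"
  shows "right_wins_first (G + depth_test N k) \<longleftrightarrow> k < depth G"
  using assms
proof (induction k arbitrary: G)
  have option_zero: "left_wins_first G" if "left_dead_end G" for G
    using that by (simp add: left_wins_first.simps left_dead_end_left_opts)
  {
    case 0
    have "\<not> left_wins_first (H + depth_test N 0)" if H: "H |\<in>| right_opts G" for H
    proof -
      have dead: "left_dead_end H"
        using H 0(1) left_dead_end_right_option by blast
      \<comment> \<open>Left's only reply enters the long run, which suffices because
        \<open>depth H < depth G \<le> N\<close>.\<close>
      have "right_wins_first (H + left_moves N)"
        using 0 dead depth_right_option[OF H] by (intro right_wins_first_left_moves) auto
      then show ?thesis
        by (simp add: left_wins_first.simps left_dead_end_left_opts[OF dead])
    qed
    then have "right_wins_first (G + depth_test N 0) \<longleftrightarrow> right_opts G \<noteq> {||}"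
      using option_zero[OF 0(1)] by (subst right_wins_first.simps) auto
    then show ?case by (simp add: depth_eq_0_iff flip: neq0_conv)
  next
    case (Suc k)
    \<comment> \<open>Left's only move uses up one waiting move, so the induction hypothesis applies
      to \<open>H\<close> with \<open>k\<close>; the move from \<open>G\<close> to \<open>H\<close>
      accounts for the shift by one.\<close>
    have "left_wins_first (H + depth_test N (Suc k)) \<longleftrightarrow> depth H \<le> k"
      if H: "H |\<in>| right_opts G" for H
    proof -
      have dead: "left_dead_end H"
        using H Suc.prems(1) left_dead_end_right_option by blast
      then have "right_wins_first (H + depth_test N k) \<longleftrightarrow> k < depth H"
        using Suc depth_right_option[OF H] by auto
      then show ?thesis
        by (auto simp: left_wins_first.simps left_dead_end_left_opts[OF dead])
    qed
    then have "right_wins_first (G + depth_test N (Suc k)) \<longleftrightarrow>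
        (\<exists>H |\<in>| right_opts G. k < depth H)"
      using option_zero[OF Suc.prems(1)] by (subst right_wins_first.simps) (auto simp: not_le)
    also have "\<dots> \<longleftrightarrow> Suc k < depth G"
    proof
      assume "Suc k < depth G"
      then show "\<exists>H |\<in>| right_opts G. k < depth H"
        using depth_attained[of G] by (metis Suc_less_eq gr0I not_less0)
    qed (use depth_right_option in fastforce)
    finally show ?case .
  }
qed

lemma right_wins_first_iff_outcome:
  "right_wins_first G \<longleftrightarrow> misere_outcome G \<in> {Next_win, Right_win}"
  by (simp add: misere_outcome_def)

lemma game_eq_depth:
  assumes "left_dead_end G" "left_dead_end H" "game_eq G H"
  shows "depth G = depth H"
proof -
  \<comment> \<open>One test must serve both games, so its final run has to be long enough for
    either depth.\<close>
  define N where "N = max (depth G) (depth H)"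
  have "right_wins_first (G + X) \<longleftrightarrow> right_wins_first (H + X)" for X
    using assms(3) by (simp add: right_wins_first_iff_outcome game_eq_iff)
  then have "k < depth G \<longleftrightarrow> k < depth H" for k
    using assms(1,2) right_wins_first_depth_test[of _ N k] by (metis N_def max.cobounded1 max.cobounded2)
  then show ?thesis by (meson linorder_neqE_nat less_irrefl)
qed

text \<open>As a form, a Left dead end is determined by its set of Right options, and these are Left
  dead ends of smaller depth. So the forms of depth at most \<open>Suc n\<close> are no more
  numerous than the subsets of a finite set.\<close>

lemma finite_left_dead_ends_depth_le: "finite {G. left_dead_end G \<and> depth G \<le> n}"
proof (induction n)
  case 0
  have "{G. left_dead_end G \<and> depth G \<le> 0} \<subseteq> {0}"
    by (auto intro: left_dead_end_depth_0)
  then show ?case by (rule finite_subset) simp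
next
  case (Suc n)
  let ?D = "{G. left_dead_end G \<and> depth G \<le> n}"
  have "G \<in> (\<lambda>S. Game {||} (Abs_fset S)) ` Pow ?D"
    if "left_dead_end G" "depth G \<le> Suc n" for G
  proof (rule image_eqI)
    show "G = Game {||} (Abs_fset (fset (right_opts G)))"
      using that by (simp add: fset_inverse game.expand left_dead_end_left_opts)
    show "fset (right_opts G) \<in> Pow ?D"
      using that left_dead_end_right_option depth_right_option by fastforce
  qed
  then show ?case
    using Suc by (auto intro: finite_subset[where B = "(\<lambda>S. Game {||} (Abs_fset S)) ` Pow ?D"])
qed

section \<open>Rank on the quotient monoid\<close>

lift_definition rank :: "left_dead_ends \<Rightarrow> nat" is depth
  using game_eq_depth by blast

lemma rank_plus: "rank (G + H) = rank G + rank H"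
  by transfer (rule depth_plus)

lemma rank_eq_0_iff: "rank G = 0 \<longleftrightarrow> G = 0"
proof
  show "G = 0" if "rank G = 0"
    using that
    by transfer (metis left_dead_end_depth_0)
  show "rank G = 0" if "G = 0"
    unfolding that by transfer (simp add: depth_eq_0_iff zero_game_def)
qed

lemma rank_sum_mset: "rank (\<Sum>\<^sub># F) = (\<Sum>A\<in>#F. rank A)"
  by (induction F) (simp_all add: rank_plus rank_eq_0_iff)

lemma finite_rank_le: "finite {G. rank G \<le> n}"
proof (rule finite_surj)
  show "finite {G. left_dead_end G \<and> depth G \<le> n}"
    by (rule finite_left_dead_ends_depth_le)
  show "{G. rank G \<le> n} \<subseteq> abs_left_dead_ends ` {G. left_dead_end G \<and> depth G \<le> n}"
  proof
    fix G assume "G \<in> {G. rank G \<le> n}"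
    \<comment> \<open>The quotient is partial, so the chosen representative has to be shown to lie
      in its domain.\<close>
    moreover have "left_dead_end (rep_left_dead_ends G)"
      using Quotient3_rep_reflp[OF Quotient3_left_dead_ends] by blast
    ultimately show "G \<in> abs_left_dead_ends ` {G. left_dead_end G \<and> depth G \<le> n}"
      by (intro image_eqI[of _ _ "rep_left_dead_ends G"])
        (simp_all add: rank.rep_eq Quotient3_abs_rep[OF Quotient3_left_dead_ends])
  qed
qed

section \<open>Existence, bounded length and finiteness of factorisations\<close>

lemma factorisation_exists: "factorisations G \<noteq> {}"
proof (induction G rule: measure_induct_rule[where f = rank])
  case (less G)
  consider "G = 0" | "atom G" | H K where "G = H + K" "H \<noteq> 0" "K \<noteq> 0"
    unfolding atom_def by blast
  then show ?case
  proof cases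
    case 1
    then have "{#} \<in> factorisations G" by (simp add: factorisations_def)
    then show ?thesis by blast
  next
    case 2
    then have "{#G#} \<in> factorisations G" by (simp add: factorisations_def)
    then show ?thesis by blast
  next
    case 3
    \<comment> \<open>Rank is additive and positive off zero, so each summand of a proper splitting
      has smaller rank.\<close>
    then have "rank H < rank G" "rank K < rank G"
      by (simp_all add: rank_plus rank_eq_0_iff flip: neq0_conv)
    then obtain E F where "E \<in> factorisations H" "F \<in> factorisations K"
      using less by blast
    with 3 have "E + F \<in> factorisations G" by (auto simp: factorisations_def)
    then show ?thesis by blast
  qed
qed

text \<open>Atoms are nonzero, so each contributes at least 1 to the additive rank.\<close>

lemma factorisation_size_le:
  assumes "F \<in> factorisations G"
  shows "size F \<le> rank G"
proof -
  have "size F = (\<Sum>A\<in>#F. 1)" by simp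
  also have "\<dots> \<le> (\<Sum>A\<in>#F. rank A)"
  proof (rule sum_mset_mono)
    fix A assume "A \<in># F"
    with assms have "A \<noteq> 0" by (auto simp: factorisations_def atom_def)
    then show "1 \<le> rank A" using rank_eq_0_iff[of A] by simp
  qed
  also have "\<dots> = rank G"
    using assms by (simp add: factorisations_def flip: rank_sum_mset)
  finally show ?thesis .
qed

lemma factorisation_rank_le:
  assumes "F \<in> factorisations G" "A \<in># F"
  shows "rank A \<le> rank G"
proof -
  obtain F' where "F = add_mset A F'" using assms(2) by (rule mset_add)
  with assms(1) show ?thesis by (auto simp: factorisations_def rank_plus)
qed

text \<open>The factors come from the finite set of elements of rank at most \<open>rank G\<close>,
  and their number is bounded. Listing the factors in some order reduces the claim to counting lists
  of bounded length over a finite set.\<close>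

lemma finite_factorisations: "finite (factorisations G)"
proof (rule finite_subset)
  let ?D = "{A. rank A \<le> rank G}"
  show "factorisations G \<subseteq> mset ` {xs. set xs \<subseteq> ?D \<and> length xs \<le> rank G}"
  proof
    fix F assume F: "F \<in> factorisations G"
    obtain xs where "mset xs = F" using ex_mset by blast
    with factorisation_size_le[OF F] factorisation_rank_le[OF F]
    show "F \<in> mset ` {xs. set xs \<subseteq> ?D \<and> length xs \<le> rank G}"
      by (intro image_eqI[of _ _ xs]) auto
  qed
  show "finite (mset ` {xs. set xs \<subseteq> ?D \<and> length xs \<le> rank G})"
    by (intro finite_imageI finite_lists_length_le finite_rank_le)
qed

theorem mainTheorem6:
  fixes G :: left_dead_ends
  shows "factorisations G \<noteq> {} \<and>
    (\<exists>b. \<forall>F \<in> factorisations G. size F \<le> b) \<and>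
    finite (factorisations G)"
  using factorisation_exists factorisation_size_le finite_factorisations by blast

end
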